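(* Let $AB$ be a fixed line segment. For each area, let $ABCD$ be the rectangle of that area applied on $AB$ (with base exactly $AB$), let $AIHG$ be the square of equal area, similarly situated to $ABCD$ with a corner at $A$, and let $J$ be the point at which the boundaries of $AIHG$ and $ABCD$ (extended if $AB<BC$) meet, as specified in the context. For all possible areas applied in the form of a rectangle on the fixed line segment $AB$, the point $J$ traces out a parabolic curve.
   Context: A rectangle is applied (exactly) on a segment $AB$ if its base is the whole of $AB$; $ABCD$ is such a rectangle, with height $AD=BC$, whose area equals that of a given rectilinear figure. The companion square $AIHG$ has the same area as $ABCD$, with $I$ on the ray $AB$ and $G$ on the ray $AD$. The point $J$ is the intersection of the side $IH$ of the square with the top side $DC$ of the rectangle; if $AB<BC$ these sides have to be extended in order to meet. Thus the distance of $J$ from the line $AD$ is $AI$ and its distance from the line $AB$ is $AD$. The segment $AB$ is fixed while the area, equivalently the height $AD$, varies. "Parabolic curve" refers to the conic called the parabola. *)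

theory Defs
  imports "HOL-Analysis.Analysis"
begin

definition line_through :: "real^2 \<Rightarrow> real^2 \<Rightarrow> (real^2) set" where
  "line_through P Q = affine hull {P, Q}"

definition ray :: "real^2 \<Rightarrow> real^2 \<Rightarrow> (real^2) set" where
  "ray P Q = {P + t *\<^sub>R (Q - P) | t. t \<ge> 0}"

text \<open>Vertices are listed in cyclic order; degenerate rectangles are excluded.\<close>

definition rectangle :: "real^2 \<Rightarrow> real^2 \<Rightarrow> real^2 \<Rightarrow> real^2 \<Rightarrow> bool" where
  "rectangle P Q R S \<longleftrightarrow>
     P \<noteq> Q \<and> P \<noteq> S \<and> R - Q = S - P \<and> (Q - P) \<bullet> (S - P) = 0"

definition square :: "real^2 \<Rightarrow> real^2 \<Rightarrow> real^2 \<Rightarrow> real^2 \<Rightarrow> bool" where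
  "square P Q R S \<longleftrightarrow> rectangle P Q R S \<and> dist P Q = dist P S"

definition area4 :: "real^2 \<Rightarrow> real^2 \<Rightarrow> real^2 \<Rightarrow> real^2 \<Rightarrow> real" where
  "area4 P Q R S = measure lebesgue (convex hull {P, Q, R, S})"

definition same_side :: "real^2 \<Rightarrow> real^2 \<Rightarrow> real^2 \<Rightarrow> real^2 \<Rightarrow> bool" where
  "same_side P Q X Y \<longleftrightarrow> closed_segment X Y \<inter> line_through P Q = {}"

text \<open>Focus \<open>F\<close> and directrix \<open>PQ\<close>.\<close>

definition parabola :: "(real^2) set \<Rightarrow> bool" where
  "parabola \<P> \<longleftrightarrow>
     (\<exists>F P Q. P \<noteq> Q \<and> F \<notin> line_through P Q \<and>
        \<P> = {X. dist X F = infdist X (line_through P Q)})"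

text \<open>
  \<open>J\<close> is the point belonging to the area \<open>s\<close> applied on the segment \<open>AB\<close>. The point \<open>E\<close>
  only serves to fix the side of \<open>AB\<close> on which the rectangles are erected. Lines rather than
  segments are intersected, since the sides \<open>IH\<close> and \<open>DC\<close> may have to be extended.
\<close>

definition application_point ::
    "real^2 \<Rightarrow> real^2 \<Rightarrow> real^2 \<Rightarrow> real \<Rightarrow> real^2 \<Rightarrow> bool" where
  "application_point A B E s J \<longleftrightarrow>
     (\<exists>C D I H G.
        rectangle A B C D \<and> same_side A B D E \<and> area4 A B C D = s \<and>
        square A I H G \<and> I \<in> ray A B \<and> G \<in> ray A D \<and> area4 A I H G = s \<and>
        line_through I H \<inter> line_through D C = {J})"

end

theory Submission
  imports Defs
begin

text \<open>
  Write \<open>a = B - A\<close> and let \<open>n\<close> be \<open>a\<close> turned by a right angle towards \<open>E\<close>. In the coordinates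
  \<open>X = A + x a + y n\<close>, whose unit of length is \<open>AB\<close>, the point \<open>J\<close> has abscissa \<open>AI\<close> and ordinate
  \<open>AD\<close>. Equality of the areas of the square and the rectangle then reads \<open>x\<^sup>2 = y\<close>, which is the
  equation of the parabola with focus \<open>(0, 1/4)\<close> and directrix \<open>y = -1/4\<close>.
\<close>

section \<open>Areas of rectangles\<close>

lemma one_eq_sum_Basis: "(1::real^'n) = \<Sum>Basis"
proof (rule euclidean_eqI)
  fix b :: "real^'n"
  assume b: "b \<in> Basis"
  then have "1 \<bullet> b = 1"
    by (auto simp: Basis_vec_def inner_axis)
  then show "1 \<bullet> b = \<Sum>Basis \<bullet> b"
    using b by simp
qed

lemma unit_square_convex_hull:
  "cbox 0 (1::real^2) = convex hull {0, axis 1 1, 1, axis 2 1}"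
proof -
  have "(\<forall>i\<in>Basis. x \<bullet> i = 0 \<or> x \<bullet> i = 1) \<longleftrightarrow> x \<in> {0, axis 1 1, 1, axis 2 1}" for x :: "real^2"
  proof -
    have "(\<forall>i\<in>Basis. x \<bullet> i = 0 \<or> x \<bullet> i = 1) \<longleftrightarrow>
        (\<forall>k. x $ k = 0 \<or> x $ k = 1)"
      by (auto simp: Basis_vec_def inner_axis)
    also have "\<dots> \<longleftrightarrow> x \<in> {0, axis 1 1, 1, axis 2 1}"
      by (auto simp: vec_eq_iff forall_2 axis_def)
    finally show ?thesis .
  qed
  then have "{x::real^2. \<forall>i\<in>Basis. x \<bullet> i = 0 \<or> x \<bullet> i = 1} = {0, axis 1 1, 1, axis 2 1}"
    by blast
  with unit_interval_convex_hull[where 'a = "real^2"] show ?thesis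
    by (simp only: flip: one_eq_sum_Basis)
qed

text \<open>A translate of a linear image of the unit square has area equal to the absolute
  determinant of the map, and for orthogonal columns this is the product of their lengths.\<close>

lemma area4_rectangle:
  assumes "rectangle P Q R S"
  shows "area4 P Q R S = dist P Q * dist P S"
proof -
  define a b where "a = Q - P" and "b = S - P"
  define f :: "real^2 \<Rightarrow> real^2" where "f = (\<lambda>w. w $ 1 *\<^sub>R a + w $ 2 *\<^sub>R b)"
  have R: "R = P + (a + b)" and orth: "a \<bullet> b = 0"
    using assms by (auto simp: rectangle_def a_def b_def algebra_simps)
  have lin: "linear f"
    by (intro linearI) (auto simp: f_def algebra_simps)
  have "{P, Q, R, S} = (+) P ` f ` {0, axis 1 1, 1, axis 2 1}"
    by (auto simp: R f_def a_def b_def axis_def)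
  then have "convex hull {P, Q, R, S} = (+) P ` f ` cbox 0 1"
    by (simp only: unit_square_convex_hull convex_hull_translation convex_hull_linear_image[OF lin])
  then have "area4 P Q R S = measure lebesgue (f ` cbox 0 1)"
    by (simp only: area4_def measure_translation)
  also have "\<dots> = \<bar>det (matrix f)\<bar> * measure lebesgue (cbox 0 (1::real^2))"
    by (rule measure_linear_image[OF lin]) simp
  also have "measure lebesgue (cbox 0 (1::real^2)) = 1"
    by (simp add: one_eq_sum_Basis content_unit)
  also have "\<bar>det (matrix f)\<bar> = norm a * norm b"
  proof -
    have "det (matrix f) = a$1 * b$2 - b$1 * a$2"
      by (simp add: det_2 matrix_def f_def axis_def)
    then have "(det (matrix f))\<^sup>2 = (a$1 * b$2 - b$1 * a$2)\<^sup>2"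
      by (rule arg_cong)
    \<comment> \<open>Lagrange's identity: the squared determinant is the Gram determinant of
      \<open>a\<close> and \<open>b\<close>.\<close>
    also have "\<dots> = (a \<bullet> a) * (b \<bullet> b) - (a \<bullet> b)\<^sup>2"
      by (simp add: inner_vec_def sum_2 power2_eq_square algebra_simps)
    finally have "(det (matrix f))\<^sup>2 = (norm a * norm b)\<^sup>2"
      by (simp add: orth power_mult_distrib power2_norm_eq_inner)
    then show ?thesis
      by (auto simp: power2_eq_iff)
  qed
  finally show ?thesis
    by (simp add: a_def b_def dist_norm norm_minus_commute)
qed

section \<open>Orthogonal coordinates with unit \<open>AB\<close>\<close>

lemma exists_rotated_vector:
  fixes a :: "real^2"
  shows "\<exists>m. norm m = norm a \<and> a \<bullet> m = 0"
proof (intro exI conjI)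
  show "norm (vector [- a$2, a$1] :: real^2) = norm a"
    by (simp add: norm_eq_sqrt_inner inner_vec_def sum_2)
  show "a \<bullet> vector [- a$2, a$1] = 0"
    by (simp add: inner_vec_def sum_2)
qed

text \<open>Both quarter turns of \<open>a\<close> qualify as \<open>n\<close>, so the side of
  \<open>E\<close> can be chosen later. Equal norms make the coordinate map a similarity with factor
  \<open>norm a\<close>.\<close>

locale frame =
  fixes A a n :: "real^2"
  assumes a_nonzero: "a \<noteq> 0"
    and norm_n: "norm n = norm a"
    and orthogonal: "a \<bullet> n = 0"
begin

definition pt :: "real \<Rightarrow> real \<Rightarrow> real^2" where
  "pt x y = A + x *\<^sub>R a + y *\<^sub>R n"

lemma inner_pt_diff:
  "(pt x y - pt x0 y0) \<bullet> (pt x' y' - pt x0' y0')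
     = ((x - x0) * (x' - x0') + (y - y0) * (y' - y0')) * (norm a)\<^sup>2"
proof -
  have "n \<bullet> n = a \<bullet> a"
    using norm_n by (metis power2_norm_eq_inner)
  then show ?thesis
    using orthogonal by (simp add: pt_def power2_norm_eq_inner algebra_simps inner_commute)
qed

lemma dist_pt: "dist (pt x y) (pt x' y') = norm a * sqrt ((x - x')\<^sup>2 + (y - y')\<^sup>2)"
  by (simp add: dist_norm norm_eq_sqrt_inner[of "pt x y - pt x' y'"] inner_pt_diff
      real_sqrt_mult power2_eq_square)

lemma pt_eq_iff [simp]: "pt x y = pt x' y' \<longleftrightarrow> x = x' \<and> y = y'"
proof -
  have "pt x y = pt x' y' \<longleftrightarrow> dist (pt x y) (pt x' y') = 0"
    by simp
  also have "\<dots> \<longleftrightarrow> x = x' \<and> y = y'"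
    unfolding dist_pt using a_nonzero by (simp add: sum_power2_eq_zero_iff)
  finally show ?thesis .
qed

lemma pt_exhaust: obtains x y where "X = pt x y"
proof -
  have n0: "n \<noteq> 0"
    using a_nonzero norm_n by auto
  \<comment> \<open>Distinctness gives \<open>{a, n}\<close> cardinality 2, so that independence
    makes it span the plane.\<close>
  have "a \<noteq> n"
    using a_nonzero orthogonal by auto
  moreover have "independent {a, n}"
    using orthogonal a_nonzero n0
    by (intro pairwise_orthogonal_independent)
       (auto simp: pairwise_def orthogonal_def inner_commute)
  ultimately have "span {a, n} = UNIV"
    using dim_eq_full[of "{a, n}"] by (simp add: dim_eq_card_independent)
  then have "X - A \<in> span {a, n}"
    by simp
  then obtain x y where "X - A - x *\<^sub>R a - y *\<^sub>R n = 0"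
    by (auto simp: span_insert)
  then have "X = pt x y"
    by (simp add: pt_def algebra_simps)
  then show thesis
    by (rule that)
qed

section \<open>Lines and the parabola in coordinates\<close>

lemma pt_diff_eq_iff:
  "pt x y - pt x0 y0 = pt x' y' - pt x0' y0' \<longleftrightarrow> x - x0 = x' - x0' \<and> y - y0 = y' - y0'"
proof -
  have "pt x y - pt x0 y0 = pt x' y' - pt x0' y0' \<longleftrightarrow> pt (x - x0) (y - y0) = pt (x' - x0') (y' - y0')"
    by (simp add: pt_def algebra_simps)
  then show ?thesis
    by simp
qed

lemma pt_affine: "pt x y + t *\<^sub>R (pt x' y' - pt x y) = pt (x + t * (x' - x)) (y + t * (y' - y))"
  by (simp add: pt_def algebra_simps)

lemma pt_in_line_through_iff:
  "pt x y \<in> line_through (pt x1 y1) (pt x2 y2) \<longleftrightarrow>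
     (\<exists>t. x = x1 + t * (x2 - x1) \<and> y = y1 + t * (y2 - y1))"
  by (auto simp: line_through_def affine_hull_2_alt pt_affine image_iff)

lemma line_through_horizontal:
  "x1 \<noteq> x2 \<Longrightarrow> line_through (pt x1 c) (pt x2 c) = range (\<lambda>x. pt x c)"
proof (rule set_eqI)
  fix X assume "x1 \<noteq> x2"
  obtain x y where X: "X = pt x y" by (rule pt_exhaust)
  have "\<exists>t. x = x1 + t * (x2 - x1)"
    using \<open>x1 \<noteq> x2\<close> by (intro exI[of _ "(x - x1) / (x2 - x1)"]) simp
  then show "X \<in> line_through (pt x1 c) (pt x2 c) \<longleftrightarrow> X \<in> range (\<lambda>x. pt x c)"
    unfolding X pt_in_line_through_iff by auto
qed

lemma line_through_vertical:
  "y1 \<noteq> y2 \<Longrightarrow> line_through (pt c y1) (pt c y2) = range (pt c)"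
proof (rule set_eqI)
  fix X assume "y1 \<noteq> y2"
  obtain x y where X: "X = pt x y" by (rule pt_exhaust)
  have "\<exists>t. y = y1 + t * (y2 - y1)"
    using \<open>y1 \<noteq> y2\<close> by (intro exI[of _ "(y - y1) / (y2 - y1)"]) simp
  then show "X \<in> line_through (pt c y1) (pt c y2) \<longleftrightarrow> X \<in> range (pt c)"
    unfolding X pt_in_line_through_iff by auto
qed

text \<open>The foot of the perpendicular, \<open>pt x c\<close>, attains the infimum; any other
  point of the line adds a square under the root.\<close>

lemma infdist_horizontal: "infdist (pt x y) (range (\<lambda>x. pt x c)) = norm a * \<bar>y - c\<bar>"
proof -
  have "(INF z\<in>range (\<lambda>x. pt x c). dist (pt x y) z) = norm a * \<bar>y - c\<bar>"
  proof (rule cInf_eq_minimum)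
    have "norm a * \<bar>y - c\<bar> = dist (pt x y) (pt x c)"
      by (simp add: dist_pt)
    then show "norm a * \<bar>y - c\<bar> \<in> dist (pt x y) ` range (\<lambda>x. pt x c)"
      by blast
  qed (auto simp: dist_pt intro!: mult_left_mono real_le_rsqrt)
  then show ?thesis
    by (simp add: infdist_def)
qed

text \<open>After squaring, the constants cancel and
  \<open>(y + 1/4)\<^sup>2 - (y - 1/4)\<^sup>2\<close> is exactly \<open>y\<close>; this is where
  1/4 comes from.\<close>

lemma dist_focus_eq_infdist_directrix_iff:
  "dist (pt x y) (pt 0 (1/4)) = infdist (pt x y) (range (\<lambda>x. pt x (- (1/4)))) \<longleftrightarrow> y = x\<^sup>2"
proof -
  have "dist (pt x y) (pt 0 (1/4)) = infdist (pt x y) (range (\<lambda>x. pt x (- (1/4)))) \<longleftrightarrow>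
      sqrt (x\<^sup>2 + (y - (1/4))\<^sup>2) = sqrt ((y + 1/4)\<^sup>2)"
    using a_nonzero by (simp add: dist_pt infdist_horizontal)
  also have "\<dots> \<longleftrightarrow> y = x\<^sup>2"
    by (simp only: real_sqrt_eq_iff) (auto simp: power2_eq_square algebra_simps)
  finally show ?thesis .
qed

lemma parabola_unit: "parabola {pt x (x\<^sup>2) | x. True}"
proof -
  have line: "line_through (pt 0 (- (1/4))) (pt 1 (- (1/4))) = range (\<lambda>x. pt x (- (1/4)))"
    by (rule line_through_horizontal) simp
  have "X \<in> {pt x (x\<^sup>2) | x. True} \<longleftrightarrow>
      dist X (pt 0 (1/4)) = infdist X (range (\<lambda>x. pt x (- (1/4))))" for X
    by (rule pt_exhaust[of X]) (auto simp: dist_focus_eq_infdist_directrix_iff)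
  then show ?thesis
    \<comment> \<open>Two points at height -1/4 span the directrix; the focus, at height 1/4, lies
      off it.\<close>
    unfolding parabola_def
    by (intro exI[of _ "pt 0 (1/4)"] exI[of _ "pt 0 (- (1/4))"] exI[of _ "pt 1 (- (1/4))"])
       (auto simp: line)
qed

section \<open>The construction in coordinates\<close>

lemma same_side_pt_iff:
  assumes "e' > 0"
  shows "same_side (pt 0 0) (pt 1 0) (pt d d') (pt e e') \<longleftrightarrow> d' > 0"
proof -
  \<comment> \<open>The height along the segment is affine in \<open>t\<close> and ends at
    \<open>e' > 0\<close>, so it vanishes somewhere exactly when it starts at a nonpositive
    value.\<close>
  have "(\<exists>t. 0 \<le> t \<and> t \<le> 1 \<and> d' + t * (e' - d') = 0) \<longleftrightarrow> d' \<le> 0"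
  proof
    assume "\<exists>t. 0 \<le> t \<and> t \<le> 1 \<and> d' + t * (e' - d') = 0"
    then obtain t where t: "0 \<le> t" "t \<le> 1" "(1 - t) * d' + t * e' = 0"
      by (auto simp: algebra_simps)
    show "d' \<le> 0"
    proof (rule ccontr)
      assume d': "\<not> d' \<le> 0"
      then have "(1 - t) * d' \<ge> 0"
        using t by simp
      then have "t = 0"
        using t assms mult_pos_pos[of t e'] by linarith
      then show False
        using t d' by simp
    qed
  next
    assume "d' \<le> 0"
    with assms show "\<exists>t. 0 \<le> t \<and> t \<le> 1 \<and> d' + t * (e' - d') = 0"
      by (intro exI[of _ "- d' / (e' - d')"]) (auto simp: field_simps)
  qed
  moreover have "closed_segment (pt d d') (pt e e')
      = {pt (d + t * (e - d)) (d' + t * (e' - d')) | t. 0 \<le> t \<and> t \<le> 1}"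
    by (auto simp: closed_segment_def pt_def algebra_simps)
  moreover have "line_through (pt 0 0) (pt 1 0) = range (\<lambda>x. pt x 0)"
    by (rule line_through_horizontal) simp
  ultimately have "same_side (pt 0 0) (pt 1 0) (pt d d') (pt e e') \<longleftrightarrow> \<not> d' \<le> 0"
    unfolding same_side_def by (auto simp: set_eq_iff)
  then show ?thesis
    by (simp only: not_le)
qed

lemma ray_pt: "ray (pt 0 0) (pt x y) = {pt (t * x) (t * y) | t. t \<ge> 0}"
  by (simp add: ray_def pt_affine)

text \<open>Orthogonality to the base forces abscissa 0 on \<open>S\<close>, and the parallelogram
  condition then fixes \<open>R\<close>. The sign of \<open>y\<close> stays free.\<close>

lemma rectangle_on_base_iff:
  assumes "x \<noteq> 0"
  shows "rectangle (pt 0 0) (pt x 0) R S \<longleftrightarrow> (\<exists>y. y \<noteq> 0 \<and> S = pt 0 y \<and> R = pt x y)"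
proof -
  obtain r r' where R: "R = pt r r'" by (rule pt_exhaust)
  obtain s s' where S: "S = pt s s'" by (rule pt_exhaust)
  show ?thesis
    using assms a_nonzero by (auto simp: R S rectangle_def inner_pt_diff pt_diff_eq_iff)
qed

text \<open>The abscissa \<open>x\<close>, which is the side of the square in units of
  \<open>AB\<close>, serves as parameter in place of the area \<open>s\<close>.\<close>

lemma application_point_iff:
  assumes "e' > 0"
  shows "application_point (pt 0 0) (pt 1 0) (pt e e') s J \<longleftrightarrow>
    (\<exists>x>0. J = pt x (x\<^sup>2) \<and> s = (norm a * x)\<^sup>2)" (is "?L \<longleftrightarrow> ?R")
proof
  assume ?L
  then obtain C D I H G where *:
      "rectangle (pt 0 0) (pt 1 0) C D" "same_side (pt 0 0) (pt 1 0) D (pt e e')"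
      "area4 (pt 0 0) (pt 1 0) C D = s"
      "square (pt 0 0) I H G" "I \<in> ray (pt 0 0) (pt 1 0)" "G \<in> ray (pt 0 0) D"
      "area4 (pt 0 0) I H G = s"
      "line_through I H \<inter> line_through D C = {J}"
    unfolding application_point_def by auto
  obtain y where y: "D = pt 0 y" "C = pt 1 y"
    using *(1) by (auto simp: rectangle_on_base_iff)
  \<comment> \<open>The side condition settles the sign, so the height enters the area without an
    absolute value.\<close>
  have "y > 0"
    using *(2) assms by (simp add: y same_side_pt_iff)
  obtain x where x: "I = pt x 0" "x \<ge> 0"
    using *(5) by (auto simp: ray_pt)
  have rect: "rectangle (pt 0 0) I H G" and side: "dist (pt 0 0) I = dist (pt 0 0) G"
    using *(4) by (auto simp: square_def)
  then have "x > 0"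
    using x by (auto simp: rectangle_def)
  obtain z where z: "G = pt 0 z" "H = pt x z" "z \<noteq> 0"
    using rect \<open>x > 0\<close> by (auto simp: x rectangle_on_base_iff)
  have s1: "s = (norm a)\<^sup>2 * y"
    using area4_rectangle[OF *(1)] *(3) \<open>y > 0\<close> by (simp add: y dist_pt power2_eq_square)
  have s2: "s = (norm a * x)\<^sup>2"
    using area4_rectangle[OF rect] *(7) side x
    by (simp add: dist_pt power2_eq_square)
  \<comment> \<open>The two expressions for the area share the nonzero factor
    \<open>(norm a)\<^sup>2\<close>.\<close>
  have "y = x\<^sup>2"
    using s1 s2 a_nonzero by (simp add: power_mult_distrib)
  moreover have "J = pt x y"
  proof -
    \<comment> \<open>Membership suffices, since the intersection is the singleton
      \<open>{J}\<close>. Here \<open>z \<noteq> 0\<close> makes \<open>I\<close> and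
      \<open>H\<close> distinct, so \<open>IH\<close> is vertical.\<close>
    have "pt x y \<in> line_through I H \<inter> line_through D C"
      using z by (simp add: x y line_through_vertical line_through_horizontal)
    then show ?thesis
      using *(8) by simp
  qed
  ultimately show ?R
    using s2 \<open>x > 0\<close> by blast
next
  assume ?R
  then obtain x where x: "x > 0" "J = pt x (x\<^sup>2)" "s = (norm a * x)\<^sup>2"
    by blast
  \<comment> \<open>The witnesses are read off from the other direction: height
    \<open>x\<^sup>2\<close> for the rectangle, side \<open>x\<close> for the square.\<close>
  have rect: "rectangle (pt 0 0) (pt 1 0) (pt 1 (x\<^sup>2)) (pt 0 (x\<^sup>2))"
    using x by (simp add: rectangle_on_base_iff)
  have rect': "rectangle (pt 0 0) (pt x 0) (pt x x) (pt 0 x)"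
    using x by (simp add: rectangle_on_base_iff)
  \<comment> \<open>The ray from \<open>A\<close> has \<open>D\<close> at parameter 1, so it reaches
    height \<open>x\<close> at parameter \<open>1 / x\<close>.\<close>
  have "x = 1 / x * x\<^sup>2"
    using x by (simp add: power2_eq_square)
  then have "pt 0 x \<in> ray (pt 0 0) (pt 0 (x\<^sup>2))"
    using x by (auto simp: ray_pt intro!: exI[of _ "1 / x"])
  moreover have "line_through (pt x 0) (pt x x) \<inter> line_through (pt 0 (x\<^sup>2)) (pt 1 (x\<^sup>2)) = {J}"
    using x by (auto simp: line_through_vertical line_through_horizontal)
  moreover have "area4 (pt 0 0) (pt 1 0) (pt 1 (x\<^sup>2)) (pt 0 (x\<^sup>2)) = s"
    using x area4_rectangle[OF rect] by (simp add: dist_pt power2_eq_square)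
  moreover have "area4 (pt 0 0) (pt x 0) (pt x x) (pt 0 x) = s"
    using x area4_rectangle[OF rect'] by (simp add: dist_pt power2_eq_square)
  moreover have "same_side (pt 0 0) (pt 1 0) (pt 0 (x\<^sup>2)) (pt e e')"
    using assms x by (simp add: same_side_pt_iff)
  moreover have "square (pt 0 0) (pt x 0) (pt x x) (pt 0 x)"
    using rect' by (simp add: square_def dist_pt)
  moreover have "pt x 0 \<in> ray (pt 0 0) (pt 1 0)"
    using x by (auto simp: ray_pt)
  ultimately show ?L
    unfolding application_point_def using rect by blast
qed

end

section \<open>Choice of the frame and conclusion\<close>

lemma exists_frame_towards:
  fixes A B E :: "real^2"
  assumes "A \<noteq> B" and "E \<notin> line_through A B"
  obtains n e e' where "frame (B - A) n" "e' > 0" "E = frame.pt A (B - A) n e e'"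
proof -
  obtain m where m: "norm m = norm (B - A)" "(B - A) \<bullet> m = 0"
    using exists_rotated_vector by blast
  \<comment> \<open>Replacing \<open>m\<close> by \<open>- m\<close> negates the ordinate of
    \<open>E\<close>, which is nonzero off the line \<open>AB\<close>; hence one of the two frames
    makes it positive.\<close>
  have fr: "frame (B - A) m" and fr': "frame (B - A) (- m)"
    using m assms by (auto simp: frame_def)
  obtain e e' where E: "E = frame.pt A (B - A) m e e'"
    by (rule frame.pt_exhaust[OF fr])
  have E': "E = frame.pt A (B - A) (- m) e (- e')"
    by (simp add: E frame.pt_def[OF fr] frame.pt_def[OF fr'])
  have "e' \<noteq> 0"
  proof
    assume "e' = 0"
    then have "E = A + e *\<^sub>R (B - A)"
      by (simp add: E frame.pt_def[OF fr])
    then show False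
      using assms(2) by (auto simp: line_through_def affine_hull_2_alt)
  qed
  then consider "e' > 0" | "- e' > 0"
    by linarith
  then show thesis
    using fr fr' E E' that by cases blast+
qed

theorem corollary1:
  fixes A B E :: "real^2"
  assumes "A \<noteq> B"
    and "E \<notin> line_through A B"
  shows "\<exists>\<P>. parabola \<P> \<and>
           {J. \<exists>s>0. application_point A B E s J} = {X \<in> \<P>. (X - A) \<bullet> (B - A) > 0}"
proof -
  obtain n e e' where fr: "frame (B - A) n" and "e' > 0"
      and E: "E = frame.pt A (B - A) n e e'"
    using assms by (rule exists_frame_towards)
  interpret frame A "B - A" n
    by (rule fr)
  have A: "A = pt 0 0" and B: "B = pt 1 0"
    by (simp_all add: pt_def)
  have pos: "norm (B - A) > 0"
    using assms by simp
  \<comment> \<open>Every \<open>x > 0\<close> occurs, because the area it determines is positive;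
    this eliminates \<open>s\<close>.\<close>
  have "(\<exists>s>0. application_point A B E s J) \<longleftrightarrow> (\<exists>x>0. J = pt x (x\<^sup>2))" for J
  proof -
    have "application_point A B E s J \<longleftrightarrow>
        (\<exists>x>0. J = pt x (x\<^sup>2) \<and> s = (norm (B - A) * x)\<^sup>2)" for s
      using application_point_iff[OF \<open>e' > 0\<close>, of e s J] by (simp flip: A B E)
    then show ?thesis
      using pos by (metis mult_pos_pos zero_less_power)
  qed
  \<comment> \<open>The inner product is \<open>x\<close> times the squared length of
    \<open>AB\<close>, so the half-plane selects the branch with positive abscissa.\<close>
  moreover have "(pt x y - A) \<bullet> (B - A) > 0 \<longleftrightarrow> x > 0" for x y
    using inner_pt_diff[of x y 0 0 1 0 0 0] pos by (simp flip: A B add: zero_less_mult_iff)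
  ultimately have "{J. \<exists>s>0. application_point A B E s J}
      = {X \<in> {pt x (x\<^sup>2) | x. True}. (X - A) \<bullet> (B - A) > 0}"
    by auto
  with parabola_unit show ?thesis
    by blast
qed

end
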